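(* Let $x_1,\dots,x_n\in\mathbb{R}^d$, $y_1,\dots,y_n\in\{-1,+1\}$, $T\ge1$, and let $Q_i^t\in\{0,1\}$, $p_i^t>0$ ($1\le i\le n$, $1\le t\le T$) be the query indicators and query probabilities of $T$ rounds of the algorithm UPAL run with the squared loss. Let $$z_i=\sum_{t=1}^T\frac{Q_i^t}{p_i^t},\qquad \hat\Sigma_z=\sum_{i=1}^n z_ix_ix_i^T,$$ and let $$\hat L_T(h)=\frac{1}{nT}\sum_{i=1}^n\sum_{t=1}^T\frac{Q_i^t}{p_i^t}(1-y_ih^Tx_i)^2,\qquad h\in\mathbb{R}^d.$$ Let $h_A\in\mathbb{R}^d$ be the hypothesis returned by UPAL after $T$ rounds, i.e. a minimizer over $h\in\mathbb{R}^d$ of $\sum_{i=1}^n\sum_{t=1}^T\frac{Q_i^t}{p_i^t}(1-y_ih^Tx_i)^2$. Define $w\in\mathbb{R}^d$ by $$w=\frac{\int_{\mathbb{R}^d}\exp(-\hat L_T(h))\,h\,\mathrm{d}h}{\int_{\mathbb{R}^d}\exp(-\hat L_T(h))\,\mathrm{d}h}.$$ Assume $\hat\Sigma_z$ is invertible. Then for every $x_0\in\mathbb{R}^d$, $w^Tx_0=h_A^Tx_0$.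
   Context: In each round $t$ of UPAL, a probability distribution $(p_i^t)_{i\le n}$ with all $p_i^t>0$ is placed on the pool $\{x_1,\dots,x_n\}$ and exactly one point is drawn from it; $Q_i^t=1$ if $x_i$ is the point drawn in round $t$ and $Q_i^t=0$ otherwise. The label of the drawn point is obtained, and the current hypothesis is updated to a minimizer over $\mathbb{R}^d$ of the importance-weighted squared loss over all rounds so far. The squared loss is $\phi(yh^Tx)=(1-yh^Tx)^2$. *)

theory Defs
  imports "HOL-Analysis.Analysis"
begin

text \<open>Points and rounds are indexed by \<open>i \<in> {1..n}\<close> and \<open>t \<in> {1..T}\<close>; the values of \<open>x\<close>, \<open>y\<close>,
  \<open>p\<close>, \<open>Q\<close> outside these ranges are irrelevant. \<open>p i t\<close> and \<open>Q i t\<close> stand for \<open>p\<^sub>i\<^sup>t\<close> and \<open>Q\<^sub>i\<^sup>t\<close>.\<close>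

definition upal_queries ::
  "nat \<Rightarrow> nat \<Rightarrow> (nat \<Rightarrow> nat \<Rightarrow> real) \<Rightarrow> (nat \<Rightarrow> nat \<Rightarrow> real) \<Rightarrow> bool" where
  "upal_queries n T p Q \<longleftrightarrow>
     (\<forall>t\<in>{1..T}.
        (\<forall>i\<in>{1..n}. 0 < p i t) \<and> (\<Sum>i=1..n. p i t) = 1 \<and>
        (\<forall>i\<in>{1..n}. Q i t \<in> {0, 1}) \<and> (\<exists>!i. i \<in> {1..n} \<and> Q i t = 1))"

definition squared_loss :: "real \<Rightarrow> real" where
  "squared_loss m = (1 - m)\<^sup>2"

definition weighted_loss ::
  "nat \<Rightarrow> nat \<Rightarrow> (nat \<Rightarrow> real^'d) \<Rightarrow> (nat \<Rightarrow> real) \<Rightarrow> (nat \<Rightarrow> nat \<Rightarrow> real)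
     \<Rightarrow> (nat \<Rightarrow> nat \<Rightarrow> real) \<Rightarrow> real^'d \<Rightarrow> real" where
  "weighted_loss n T x y p Q h =
     (\<Sum>i=1..n. \<Sum>t=1..T. Q i t / p i t * squared_loss (y i * (h \<bullet> x i)))"

definition upal_hypothesis ::
  "nat \<Rightarrow> nat \<Rightarrow> (nat \<Rightarrow> real^'d) \<Rightarrow> (nat \<Rightarrow> real) \<Rightarrow> (nat \<Rightarrow> nat \<Rightarrow> real)
     \<Rightarrow> (nat \<Rightarrow> nat \<Rightarrow> real) \<Rightarrow> real^'d \<Rightarrow> bool" where
  "upal_hypothesis n T x y p Q h \<longleftrightarrow> is_arg_min (weighted_loss n T x y p Q) (\<lambda>_. True) h"

definition empirical_risk ::
  "nat \<Rightarrow> nat \<Rightarrow> (nat \<Rightarrow> real^'d) \<Rightarrow> (nat \<Rightarrow> real) \<Rightarrow> (nat \<Rightarrow> nat \<Rightarrow> real)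
     \<Rightarrow> (nat \<Rightarrow> nat \<Rightarrow> real) \<Rightarrow> real^'d \<Rightarrow> real" where
  "empirical_risk n T x y p Q h = 1 / (real n * real T) * weighted_loss n T x y p Q h"

definition importance_weight ::
  "nat \<Rightarrow> (nat \<Rightarrow> nat \<Rightarrow> real) \<Rightarrow> (nat \<Rightarrow> nat \<Rightarrow> real) \<Rightarrow> nat \<Rightarrow> real" where
  "importance_weight T p Q i = (\<Sum>t=1..T. Q i t / p i t)"

definition outer_product :: "real^'d \<Rightarrow> real^'d \<Rightarrow> real^'d^'d" where
  "outer_product u v = (\<chi> a b. u $ a * v $ b)"

definition weighted_covariance ::
  "nat \<Rightarrow> nat \<Rightarrow> (nat \<Rightarrow> real^'d) \<Rightarrow> (nat \<Rightarrow> nat \<Rightarrow> real) \<Rightarrow> (nat \<Rightarrow> nat \<Rightarrow> real)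
     \<Rightarrow> real^'d^'d" where
  "weighted_covariance n T x p Q =
     (\<Sum>i=1..n. importance_weight T p Q i *\<^sub>R outer_product (x i) (x i))"

definition gibbs_mean :: "(real^'d \<Rightarrow> real) \<Rightarrow> real^'d" where
  "gibbs_mean L =
     (1 / (LINT h|lborel. exp (- L h))) *\<^sub>R (LINT h|lborel. exp (- L h) *\<^sub>R h)"

end

theory Submission
  imports Defs "HOL-Probability.Distributions"
begin

text \<open>Minimality removes the linear term of the quadratic \<open>weighted_loss\<close> at \<open>h\<^sub>A\<close>, so the Gibbs
  density \<open>exp (- L)\<close> is a Gaussian symmetric about \<open>h\<^sub>A\<close>; invertibility of the weighted covariance
  makes its first moment finite. Reflection in \<open>h\<^sub>A\<close> then forces the mean to be \<open>h\<^sub>A\<close>.\<close>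

section \<open>Gaussian integrability\<close>

lemma integrable_gaussian_real:
  fixes c m :: real
  assumes "0 < c"
  shows "integrable lborel (\<lambda>t. exp (- c * (t - m)\<^sup>2))"
proof -
  \<comment> \<open>With variance \<open>1 / (2 * c)\<close>, the exponent of
    \<open>normal_density m s\<close> becomes exactly that of the integrand, so only the normalizing
    factor differs.\<close>
  define s where "s = sqrt (1 / (2 * c))"
  have s2: "s\<^sup>2 = 1 / (2 * c)" and s: "0 < s"
    using assms by (simp_all add: s_def)
  have "integrable lborel (\<lambda>t. sqrt (2 * pi * s\<^sup>2) * normal_density m s t)"
    by (intro integrable_mult_right integrable_normal_density s)
  also have "(\<lambda>t. sqrt (2 * pi * s\<^sup>2) * normal_density m s t) = (\<lambda>t. exp (- c * (t - m)\<^sup>2))"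
    using assms s unfolding normal_density_def
    by (intro ext) (simp add: s2 field_simps)
  finally show ?thesis .
qed

text \<open>The squared norm is a sum over coordinates, so the integrand factors and its integral is
  a finite product of one-dimensional Gaussian integrals.\<close>

lemma integrable_gaussian:
  fixes a :: "'a::euclidean_space"
  assumes "0 < c"
  shows "integrable lborel (\<lambda>h. exp (- c * (norm (h - a))\<^sup>2))"
proof -
  have "exp (- c * (norm (h - a))\<^sup>2) = (\<Prod>b\<in>Basis. exp (- c * (h \<bullet> b - a \<bullet> b)\<^sup>2))" for h
  proof -
    have "(norm (h - a))\<^sup>2 = (\<Sum>b\<in>Basis. (h \<bullet> b - a \<bullet> b)\<^sup>2)"
      unfolding power2_norm_eq_inner by (subst euclidean_inner) (simp add: inner_diff_left power2_eq_square)
    then show ?thesis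
      by (simp add: exp_sum[symmetric] sum_distrib_left)
  qed
  then have "(\<integral>\<^sup>+h. ennreal (exp (- c * (norm (h - a))\<^sup>2)) \<partial>lborel) =
      (\<integral>\<^sup>+h. (\<Prod>b\<in>Basis. ennreal (exp (- c * (h \<bullet> b - a \<bullet> b)\<^sup>2))) \<partial>lborel)"
    by (simp add: prod_ennreal)
  also have "\<dots> = (\<Prod>b\<in>Basis. \<integral>\<^sup>+t. ennreal (exp (- c * (t - a \<bullet> b)\<^sup>2)) \<partial>lborel)"
    by (rule nn_integral_lborel_prod) auto
  also have "\<dots> < \<infinity>"
    using integrable_gaussian_real[OF assms]
    by (simp add: ennreal_prod_eq_top less_top[symmetric] integrable_iff_bounded)
  finally show ?thesis
    by (simp add: integrable_iff_bounded)
qed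

text \<open>Half of the exponent is spent on absorbing the factor \<open>norm (h - a)\<close>; what
  remains is a Gaussian with rate \<open>c / 2\<close>.\<close>

lemma integrable_gaussian_first_moment:
  fixes a :: "'a::euclidean_space"
  assumes "0 < c"
  shows "integrable lborel (\<lambda>h. exp (- c * (norm (h - a))\<^sup>2) *\<^sub>R (h - a))"
proof (rule Bochner_Integration.integrable_bound)
  show "integrable lborel (\<lambda>h. (1 + 2 / c) * exp (- (c / 2) * (norm (h - a))\<^sup>2))"
    using integrable_gaussian[of "c / 2" a] assms by (intro integrable_mult_right) auto
  have "exp (- c * r\<^sup>2) * r \<le> (1 + 2 / c) * exp (- (c / 2) * r\<^sup>2)" for r :: real
  proof -
    have "2 * r \<le> 1 + r\<^sup>2"
      using sum_squares_bound[of r 1] by simp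
    then have "r \<le> 1 + r\<^sup>2"
      using zero_le_power2[of r] by linarith
    \<comment> \<open>The product expands to \<open>1 + r^2\<close> plus two nonnegative terms; the
      factor \<open>1 + 2 / c\<close> is chosen so that \<open>c / 2 * r^2\<close> contributes a
      full \<open>r^2\<close>.\<close>
    also have "\<dots> \<le> (1 + 2 / c) * (1 + c / 2 * r\<^sup>2)"
      using assms by (simp add: field_simps)
    also have "\<dots> \<le> (1 + 2 / c) * exp (c / 2 * r\<^sup>2)"
      using assms by (intro mult_left_mono exp_ge_add_one_self) auto
    finally have "exp (- c * r\<^sup>2) * r \<le> exp (- c * r\<^sup>2) * ((1 + 2 / c) * exp (c / 2 * r\<^sup>2))"
      by (intro mult_left_mono) auto
    also have "\<dots> = (1 + 2 / c) * exp (- (c / 2) * r\<^sup>2)"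
      by (simp add: exp_add[symmetric] field_simps)
    finally show ?thesis .
  qed
  then show "AE h in lborel. norm (exp (- c * (norm (h - a))\<^sup>2) *\<^sub>R (h - a))
      \<le> norm ((1 + 2 / c) * exp (- (c / 2) * (norm (h - a))\<^sup>2))"
    using assms by (simp add: abs_mult)
qed measurable

section \<open>Point reflection and the mean of a symmetric Gibbs density\<close>

lemma lborel_integral_reflect:
  fixes f :: "'a::euclidean_space \<Rightarrow> 'b::{banach, second_countable_topology}"
  assumes [measurable]: "f \<in> borel_measurable borel"
  shows "(LINT h|lborel. f (t - h)) = (LINT h|lborel. f h)"
proof -
  \<comment> \<open>The map is affine with linear factor -1, whose Jacobian has absolute value
    1.\<close>
  have "lborel = distr lborel borel (\<lambda>h::'a. t - h)"
    using lborel_affine[of "-1" t] by (simp add: density_1)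
  then have "(LINT h|lborel. f h) = (LINT h|distr lborel borel (\<lambda>h. t - h). f h)"
    by (rule arg_cong)
  also have "\<dots> = (LINT h|lborel. f (t - h))"
    by (rule integral_distr) auto
  finally show ?thesis ..
qed

text \<open>The growth bound dominates \<open>exp (- L h)\<close> and its first moment about
  \<open>a\<close> by Gaussian terms, so the integrals below are genuine and may be split; the
  symmetry then makes the first moment about \<open>a\<close> equal to its own negative.\<close>

lemma gibbs_mean_eq_center:
  fixes L :: "real^'d \<Rightarrow> real"
  assumes [measurable]: "L \<in> borel_measurable borel"
    and sym: "\<And>v. L (a - v) = L (a + v)"
    and c: "0 < c" "\<And>v. L (a + v) \<ge> L a + c * (norm v)\<^sup>2"
  shows "gibbs_mean L = a"
proof -
  have bound: "exp (- L h) \<le> exp (- L a) * exp (- c * (norm (h - a))\<^sup>2)" for h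
    using c(2)[of "h - a"] by (simp add: exp_add[symmetric])
  have int0: "integrable lborel (\<lambda>h. exp (- L h))"
    by (rule Bochner_Integration.integrable_bound
        [OF integrable_mult_right[OF integrable_gaussian[OF c(1)], of "exp (- L a)" a]])
      (use bound in auto)
  have int1: "integrable lborel (\<lambda>h. exp (- L h) *\<^sub>R (h - a))"
  proof (rule Bochner_Integration.integrable_bound
      [OF integrable_scaleR_right[OF integrable_gaussian_first_moment[OF c(1)], of "exp (- L a)" a]])
    show "AE h in lborel. norm (exp (- L h) *\<^sub>R (h - a)) \<le>
        norm (exp (- L a) *\<^sub>R exp (- c * (norm (h - a))\<^sup>2) *\<^sub>R (h - a))"
      using mult_right_mono[OF bound norm_ge_zero] by (auto simp: mult.assoc)
  qed measurable
  define I where "I = (LINT h|lborel. exp (- L h) *\<^sub>R (h - a))"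
  have "L (2 *\<^sub>R a - h) = L h" for h
    using sym[of "h - a"] by (simp add: scaleR_2 algebra_simps)
  \<comment> \<open>Substituting \<open>2 *\<^sub>R a - h\<close> for \<open>h\<close> fixes the
    density and turns \<open>h - a\<close> into \<open>a - h\<close>.\<close>
  then have "(LINT h|lborel. exp (- L h) *\<^sub>R (a - h)) = I"
    unfolding I_def
    by (subst (2) lborel_integral_reflect[symmetric, of _ "2 *\<^sub>R a"])
      (simp_all add: scaleR_2 algebra_simps)
  moreover have "(LINT h|lborel. exp (- L h) *\<^sub>R (a - h)) = - I"
    unfolding I_def by (subst integral_minus[symmetric]) (simp add: scaleR_right_diff_distrib)
  ultimately have "I = - I"
    by simp
  then have "2 *\<^sub>R I = 0"
    by (simp add: scaleR_2 eq_neg_iff_add_eq_0)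
  then have I0: "I = 0"
    by simp
  have "(LINT h|lborel. exp (- L h) *\<^sub>R h) = (LINT h|lborel. exp (- L h) *\<^sub>R (h - a) + exp (- L h) *\<^sub>R a)"
    by (simp add: scaleR_right_diff_distrib)
  also have "\<dots> = I + (LINT h|lborel. exp (- L h) *\<^sub>R a)"
    unfolding I_def by (intro Bochner_Integration.integral_add int1 integrable_scaleR_left int0)
  also have "\<dots> = (LINT h|lborel. exp (- L h)) *\<^sub>R a"
    using I0 int0 by simp
  finally have mean: "(LINT h|lborel. exp (- L h) *\<^sub>R h) = (LINT h|lborel. exp (- L h)) *\<^sub>R a" .
  \<comment> \<open>The normalizer must not fall under the convention \<open>1 / 0 = 0\<close>. If
    it vanished, a strictly positive function would be zero almost everywhere.\<close>
  have "(LINT h|lborel. exp (- L h)) \<noteq> 0"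
  proof
    assume "(LINT h|lborel. exp (- L h)) = 0"
    then have "AE h in lborel. exp (- L h) = 0"
      using integral_nonneg_eq_0_iff_AE[OF int0] by simp
    then have "AE h::real^'d in lborel. False"
      by simp
    then show False
      by (simp add: AE_iff_measurable[OF _ refl] emeasure_lborel_UNIV)
  qed
  then show ?thesis
    by (simp add: gibbs_mean_def mean)
qed

section \<open>The weighted loss as a positive definite quadratic\<close>

lemma weighted_loss_eq:
  "weighted_loss n T x y p Q h =
    (\<Sum>i=1..n. importance_weight T p Q i * (1 - y i * (h \<bullet> x i))\<^sup>2)"
  by (simp add: weighted_loss_def importance_weight_def squared_loss_def sum_distrib_right)

lemma weighted_covariance_mult_vec:
  "weighted_covariance n T x p Q *v v =
    (\<Sum>i=1..n. (importance_weight T p Q i * (v \<bullet> x i)) *\<^sub>R x i)"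
  by (simp add: vec_eq_iff weighted_covariance_def outer_product_def matrix_vector_mult_def
      inner_vec_def sum_distrib_left sum_distrib_right, subst sum.swap)
    (simp add: algebra_simps)

text \<open>The loss is quadratic, so the second-order expansion is exact. The labels satisfy
  \<open>y i * y i = 1\<close> and therefore disappear from the quadratic term.\<close>

lemma weighted_loss_add:
  assumes "\<forall>i\<in>{1..n}. y i \<in> {-1, 1}"
  shows "weighted_loss n T x y p Q (a + v) = weighted_loss n T x y p Q a
    - 2 * (\<Sum>i=1..n. importance_weight T p Q i * (1 - y i * (a \<bullet> x i)) * y i * (v \<bullet> x i))
    + v \<bullet> (weighted_covariance n T x p Q *v v)"
proof -
  have "importance_weight T p Q i * (1 - y i * ((a + v) \<bullet> x i))\<^sup>2 =
      importance_weight T p Q i * (1 - y i * (a \<bullet> x i))\<^sup>2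
      - 2 * (importance_weight T p Q i * (1 - y i * (a \<bullet> x i)) * y i * (v \<bullet> x i))
      + importance_weight T p Q i * (v \<bullet> x i) * (v \<bullet> x i)" if "i \<in> {1..n}" for i
    using bspec[OF assms that]
    by (auto simp: inner_add_left power2_eq_square algebra_simps)
  then show ?thesis
    unfolding weighted_loss_eq weighted_covariance_mult_vec inner_sum_right sum_distrib_left
      sum_subtractf[symmetric] sum.distrib[symmetric]
    by (intro sum.cong refl) (simp only: inner_scaleR_right)
qed

text \<open>The form is a weighted sum of squares. If it vanishes at \<open>v\<close>, each term
  does, so the matrix sends \<open>v\<close> to 0, against injectivity.\<close>

lemma weighted_covariance_pos_def:
  assumes "\<And>i. i \<in> {1..n} \<Longrightarrow> importance_weight T p Q i \<ge> 0"
    and "invertible (weighted_covariance n T x p Q)" "v \<noteq> 0"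
  shows "v \<bullet> (weighted_covariance n T x p Q *v v) > 0"
proof -
  let ?z = "importance_weight T p Q"
  have eq: "v \<bullet> (weighted_covariance n T x p Q *v v) = (\<Sum>i=1..n. ?z i * (v \<bullet> x i)\<^sup>2)"
    by (simp add: weighted_covariance_mult_vec inner_sum_right power2_eq_square mult.assoc)
  have "(\<Sum>i=1..n. ?z i * (v \<bullet> x i)\<^sup>2) \<noteq> 0"
  proof
    assume "(\<Sum>i=1..n. ?z i * (v \<bullet> x i)\<^sup>2) = 0"
    then have "\<forall>i\<in>{1..n}. ?z i * (v \<bullet> x i)\<^sup>2 = 0"
      using assms(1) by (subst (asm) sum_nonneg_eq_0_iff) auto
    then have "weighted_covariance n T x p Q *v v = 0"
      unfolding weighted_covariance_mult_vec by (intro sum.neutral) auto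
    then show False
      using injD[OF inj_matrix_vector_mult[OF assms(2)], of v 0] assms(3) by simp
  qed
  moreover have "(\<Sum>i=1..n. ?z i * (v \<bullet> x i)\<^sup>2) \<ge> 0"
    using assms(1) by (intro sum_nonneg) auto
  ultimately show ?thesis
    using eq by simp
qed

text \<open>The constant is the minimum of the form on the compact unit sphere; homogeneity of
  degree 2 carries the bound to all vectors.\<close>

lemma pos_def_lower_bound:
  fixes A :: "real^'d^'d"
  assumes "\<And>v. v \<noteq> 0 \<Longrightarrow> v \<bullet> (A *v v) > 0"
  obtains c where "c > 0" "\<And>v. v \<bullet> (A *v v) \<ge> c * (norm v)\<^sup>2"
proof -
  have "continuous_on (sphere 0 1) (\<lambda>v. v \<bullet> (A *v v))"
    by (intro continuous_intros)
  moreover have "sphere (0::real^'d) 1 \<noteq> {}"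
    by simp
  ultimately obtain u where u: "u \<in> sphere 0 1" "\<And>v. v \<in> sphere 0 1 \<Longrightarrow> u \<bullet> (A *v u) \<le> v \<bullet> (A *v v)"
    using continuous_attains_inf[OF compact_sphere, of 0 1 "\<lambda>v. v \<bullet> (A *v v)"] by blast
  show ?thesis
  proof
    show "u \<bullet> (A *v u) > 0"
      using u(1) by (intro assms) auto
    fix v :: "real^'d"
    show "v \<bullet> (A *v v) \<ge> (u \<bullet> (A *v u)) * (norm v)\<^sup>2"
    proof (cases "v = 0")
      case False
      define e where "e = (1 / norm v) *\<^sub>R v"
      have v: "v = norm v *\<^sub>R e" and "e \<in> sphere 0 1"
        using False by (simp_all add: e_def)
      have "v \<bullet> (A *v v) = (norm v)\<^sup>2 * (e \<bullet> (A *v e))"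
        by (subst (1 2) v) (simp add: matrix_vector_mult_scaleR power2_eq_square)
      then show ?thesis
        using u(2)[OF \<open>e \<in> sphere 0 1\<close>] by (simp add: mult.commute mult_right_mono)
    qed simp
  qed
qed

text \<open>At its vertex \<open>s = b / q\<close> the parabola takes the value
  \<open>- (b^2 / q)\<close>, which is nonnegative only for \<open>b = 0\<close>.\<close>

lemma quadratic_nonneg_imp_linear_zero:
  fixes b q :: real
  assumes "q > 0" "\<And>s. s\<^sup>2 * q - 2 * s * b \<ge> 0"
  shows "b = 0"
proof -
  have "(b / q)\<^sup>2 * q - 2 * (b / q) * b = - (b\<^sup>2 / q)"
    using assms(1) by (simp add: field_simps power2_eq_square)
  then have "b\<^sup>2 / q \<le> 0"
    using assms(2)[of "b / q"] by simp
  then show ?thesis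
    using assms(1) by (simp add: divide_le_0_iff)
qed

theorem theorem2:
  fixes n T :: nat
    and x :: "nat \<Rightarrow> real^'d"
    and y :: "nat \<Rightarrow> real"
    and p Q :: "nat \<Rightarrow> nat \<Rightarrow> real"
    and h\<^sub>A w :: "real^'d"
  assumes "\<forall>i\<in>{1..n}. y i \<in> {-1, 1}"
    and "T \<ge> 1"
    and "upal_queries n T p Q"
    and "upal_hypothesis n T x y p Q h\<^sub>A"
    and "w = gibbs_mean (empirical_risk n T x y p Q)"
    and "invertible (weighted_covariance n T x p Q)"
  shows "\<forall>x\<^sub>0. w \<bullet> x\<^sub>0 = h\<^sub>A \<bullet> x\<^sub>0"
proof -
  let ?S = "weighted_covariance n T x p Q" and ?F = "weighted_loss n T x y p Q"
  \<comment> \<open>\<open>B v\<close> is minus half the directional derivative of the loss at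
    \<open>h\<^sub>A\<close> along \<open>v\<close>.\<close>
  define B where
    "B v = (\<Sum>i=1..n. importance_weight T p Q i * (1 - y i * (h\<^sub>A \<bullet> x i)) * y i * (v \<bullet> x i))" for v
  have F: "?F (h\<^sub>A + v) = ?F h\<^sub>A - 2 * B v + v \<bullet> (?S *v v)" for v
    unfolding B_def by (rule weighted_loss_add[OF assms(1)])
  have "importance_weight T p Q i \<ge> 0" if "i \<in> {1..n}" for i
    unfolding importance_weight_def
  proof (rule sum_nonneg)
    fix t assume "t \<in> {1..T}"
    then have "p i t > 0" "Q i t \<in> {0, 1}"
      using assms(3) that unfolding upal_queries_def by blast+
    then show "Q i t / p i t \<ge> 0"
      by auto
  qed
  then have pos: "v \<bullet> (?S *v v) > 0" if "v \<noteq> 0" for v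
    using weighted_covariance_pos_def assms(6) that by blast
  have B0: "B v = 0" for v
  proof (cases "v = 0")
    case False
    show ?thesis
    proof (rule quadratic_nonneg_imp_linear_zero[OF pos[OF False]])
      fix s :: real
      \<comment> \<open>Minimality is used along the whole line through \<open>h\<^sub>A\<close> in
        direction \<open>v\<close>, which replaces differentiation.\<close>
      have "?F h\<^sub>A \<le> ?F (h\<^sub>A + s *\<^sub>R v)"
        using assms(4) by (simp add: upal_hypothesis_def is_arg_min_linorder)
      moreover have "B (s *\<^sub>R v) = s * B v"
        by (simp add: B_def sum_distrib_left mult_ac)
      ultimately show "s\<^sup>2 * (v \<bullet> (?S *v v)) - 2 * s * B v \<ge> 0"
        unfolding F by (simp add: matrix_vector_mult_scaleR power2_eq_square)
    qed
  qed (simp add: B_def)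
  \<comment> \<open>Some round takes place and draws a point, so the pool is nonempty and the
    scaling \<open>1 / (real n * real T)\<close> is not a division by zero.\<close>
  have "n \<ge> 1"
    using assms(2,3) by (force simp: upal_queries_def)
  then have k: "1 / (real n * real T) > 0"
    using assms(2) by simp
  obtain c where c: "c > 0" "\<And>v. v \<bullet> (?S *v v) \<ge> c * (norm v)\<^sup>2"
    using pos_def_lower_bound[OF pos] by blast
  have "gibbs_mean (empirical_risk n T x y p Q) = h\<^sub>A"
  proof (rule gibbs_mean_eq_center)
    show "empirical_risk n T x y p Q \<in> borel_measurable borel"
      unfolding empirical_risk_def weighted_loss_eq
      by (intro borel_measurable_continuous_onI continuous_intros)
    \<comment> \<open>Without the linear term, the increment from \<open>h\<^sub>A\<close> is a
      quadratic form, hence even in \<open>v\<close>.\<close>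
    show "empirical_risk n T x y p Q (h\<^sub>A - v) = empirical_risk n T x y p Q (h\<^sub>A + v)" for v
      using F[of v] F[of "- v"] by (simp add: empirical_risk_def B0 vec.neg)
    show "1 / (real n * real T) * c > 0"
      using k c(1) by (rule mult_pos_pos)
    show "empirical_risk n T x y p Q (h\<^sub>A + v) \<ge>
        empirical_risk n T x y p Q h\<^sub>A + 1 / (real n * real T) * c * (norm v)\<^sup>2" for v
      using mult_left_mono[OF c(2)[of v] less_imp_le[OF k]]
      by (simp only: empirical_risk_def F B0) (simp add: distrib_left add_divide_distrib)
  qed
  then show ?thesis
    using assms(5) by simp
qed

end
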